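(* Let $A\in\mathbb{R}^{m\times n}$, let $P$ and $A_{(k)}$ be produced by the randomized algorithm described in the context with target rank $k$ and oversampling parameter $p$, $k+p\le\min\{m,n\}$, and let $\widetilde\sigma_1\ge\widetilde\sigma_2\ge\cdots\ge\widetilde\sigma_{k+p}$ be the singular values of $AP$. Then $$\|A-A_{(k)}\|\le\widetilde\sigma_{k+1}+\|A(I-PP^T)\|$$ with $$\sigma_{n-p+1}\le\widetilde\sigma_{k+1}\le\sigma_{k+1}.$$
   Context: $\|\cdot\|$ is the matrix 2-norm. $A\in\mathbb{R}^{m\times n}$ is arbitrary ($m\ge n$ or $m\leq n$, singular values not necessarily simple), with singular values $\sigma_1\ge\sigma_2\ge\cdots\ge\sigma_{\min\{m,n\}}$, and by convention $\sigma_{\min\{m,n\}+1}=\cdots=\sigma_n=0$, so that $\sigma_1^2,\ldots,\sigma_n^2$ are the eigenvalues of $A^TA$. The integers $k\ge1$, $p\ge1$ satisfy $\ell=k+p\le\min\{m,n\}$. Randomized algorithm (the right-subspace variant, which amounts to applying the standard randomized SVD algorithm to $A^T$): draw an $m\times\ell$ Gaussian random matrix $\Omega$; form $Y=A^T\Omega\in\mathbb{R}^{n\times\ell}$; compute the compact QR factorization $Y=PR$ with $P\in\mathbb{R}^{n\times\ell}$ having orthonormal columns; form $AP\in\mathbb{R}^{m\times\ell}$ and compute its compact SVD; let $(AP)_{(k)}$ be the best rank $k$ approximation to $AP$ obtained by keeping its $k$ largest singular values and the corresponding singular vectors; output the truncated rank $k$ approximation $A_{(k)}=(AP)_{(k)}P^T$.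 *)

theory Defs
  imports "HOL-Probability.Probability"
begin

text \<open>An \<open>m \<times> n\<close> real matrix has type \<^typ>\<open>real ^ 'n ^ 'm\<close>. The \<open>norm\<close> of that type is the
  Frobenius norm; the matrix 2-norm is the operator norm below.\<close>

abbreviation matrix_2norm :: "real ^ 'n ^ 'm \<Rightarrow> real"
  where "matrix_2norm B \<equiv> onorm ((*v) B)"

definition charpoly :: "real ^ 'n ^ 'n \<Rightarrow> real poly"
  where "charpoly B = det (mat [:0, 1:] - (\<chi> i j. [:B $ i $ j:]))"

definition eigenvalues_desc :: "real ^ 'n ^ 'n \<Rightarrow> real list"
  where "eigenvalues_desc B = rev (sorted_list_of_multiset (proots (charpoly B)))"

text \<open>Indices are 1-based, while \<open>!\<close> is 0-based. For an \<open>m \<times> n\<close> matrix \<open>B\<close>, the product \<open>B\<^sup>T B\<close> is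
  symmetric, so it has \<open>n\<close> real eigenvalues counted with multiplicity; hence \<open>singular_value B i\<close>
  is meaningful for \<open>1 \<le> i \<le> n\<close>, and it is 0 for \<open>min m n < i \<le> n\<close>.\<close>

definition singular_value :: "real ^ 'n ^ 'm \<Rightarrow> nat \<Rightarrow> real"
  where "singular_value B i = sqrt (eigenvalues_desc (transpose B ** B) ! (i - 1))"

text \<open>The columns of an \<open>n \<times> l\<close> factor are indexed by a finite linearly ordered type, whose order
  gives a meaning to ``upper triangular'' and to ``the first \<open>k\<close> columns''.\<close>

definition compact_qr ::
    "real ^ 'l::{finite,linorder} ^ 'n \<Rightarrow> real ^ 'l::{finite,linorder} ^ 'n \<Rightarrow>
     real ^ 'l::{finite,linorder} ^ 'l::{finite,linorder} \<Rightarrow> bool"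
  where "compact_qr Y P R \<longleftrightarrow>
    Y = P ** R \<and> transpose P ** P = mat 1 \<and> (\<forall>i j. j < i \<longrightarrow> R $ i $ j = 0)"

text \<open>The compact SVD \<open>B = U S V\<^sup>T\<close> of a matrix with at least as many rows as columns.\<close>

definition compact_svd ::
    "real ^ 'l::{finite,linorder} ^ 'm \<Rightarrow>
     real ^ 'l::{finite,linorder} ^ 'm \<Rightarrow>
     real ^ 'l::{finite,linorder} ^ 'l::{finite,linorder} \<Rightarrow>
     real ^ 'l::{finite,linorder} ^ 'l::{finite,linorder} \<Rightarrow> bool"
  where "compact_svd B U S V \<longleftrightarrow>
    B = U ** S ** transpose V \<and> transpose U ** U = mat 1 \<and> orthogonal_matrix V \<and>
    (\<forall>i j. i \<noteq> j \<longrightarrow> S $ i $ j = 0) \<and> (\<forall>i. 0 \<le> S $ i $ i) \<and>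
    (\<forall>i j. i \<le> j \<longrightarrow> S $ j $ j \<le> S $ i $ i)"

text \<open>Here \<open>card {..<i} < k\<close> says that \<open>i\<close> is one of the first \<open>k\<close> column indices.\<close>

definition svd_truncation ::
    "nat \<Rightarrow> real ^ 'l::{finite,linorder} ^ 'm \<Rightarrow>
     real ^ 'l::{finite,linorder} ^ 'l::{finite,linorder} \<Rightarrow>
     real ^ 'l::{finite,linorder} ^ 'l::{finite,linorder} \<Rightarrow>
     real ^ 'l::{finite,linorder} ^ 'm"
  where "svd_truncation k U S V =
    U ** (\<chi> i j. if card {..<i} < k then S $ i $ j else 0) ** transpose V"

definition gaussian_matrix :: "'w measure \<Rightarrow> ('w \<Rightarrow> real ^ 'l ^ 'm) \<Rightarrow> bool"
  where "gaussian_matrix M \<Omega> \<longleftrightarrow> prob_space M \<and>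
    prob_space.indep_vars M (\<lambda>_. borel) (\<lambda>(i, j) \<omega>. \<Omega> \<omega> $ i $ j) UNIV \<and>
    (\<forall>i j. distributed M lborel (\<lambda>\<omega>. \<Omega> \<omega> $ i $ j) std_normal_density)"

text \<open>\<open>rsvd_right k A G P Ak\<close>: with the drawn test matrix \<open>G\<close>, the right-subspace randomized SVD
  algorithm can produce the orthonormal factor \<open>P\<close> and the output \<open>Ak\<close>. It is a relation because
  the QR and singular value decompositions are not unique.\<close>

definition rsvd_right ::
    "nat \<Rightarrow> real ^ 'n ^ 'm \<Rightarrow> real ^ 'l::{finite,linorder} ^ 'm \<Rightarrow>
     real ^ 'l::{finite,linorder} ^ 'n \<Rightarrow> real ^ 'n ^ 'm \<Rightarrow> bool"
  where "rsvd_right k A G P Ak \<longleftrightarrow>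
    (\<exists>R U S V. compact_qr (transpose A ** G) P R \<and> compact_svd (A ** P) U S V \<and>
      Ak = svd_truncation k U S V ** transpose P)"

end

theory Submission
  imports Defs
begin

text \<open>Only two properties of the algorithm matter: \<open>P\<close> has orthonormal columns, and the output is
  \<open>T P\<^sup>T\<close>, where \<open>T\<close> is the truncation of a compact SVD of \<open>A P\<close>. The bounds hold for every draw of
  the test matrix.

  \<^bold>\<open>Error bound.\<close> Split \<open>A - T P\<^sup>T = (A P - T) P\<^sup>T + A (I - P P\<^sup>T)\<close>. As \<open>\<parallel>P\<^sup>T\<parallel> \<le> 1\<close>, the triangle
  inequality leaves \<open>\<parallel>A P - T\<parallel>\<close>. Up to isometries, \<open>A P - T\<close> is diagonal with the discarded
  diagonal entries of the SVD, each of which is at most the \<open>(k+1)\<close>-st singular value of \<open>A P\<close>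
  (\<open>svd_truncation_error\<close>).

  \<^bold>\<open>Interlacing.\<close> The other two inequalities are the Cauchy--Poincare separation theorem for
  \<open>A\<^sup>T A\<close> and its compression \<open>P\<^sup>T A\<^sup>T A P\<close>. Take orthonormal eigenvectors \<open>u\<^sub>i\<close> of the first
  and \<open>v\<^sub>j\<close> of the second. The vectors \<open>P v\<^sub>j\<close> are again orthonormal, and their images under \<open>A\<close> are
  mutually orthogonal. If an inequality failed, then for a suitable \<open>t\<close> the vectors of one family
  with eigenvalue above \<open>t\<close> and those of the other with eigenvalue at most \<open>t\<close> would together be
  more than \<open>n\<close>, so that their spans share some \<open>x \<noteq> 0\<close>. Then both \<open>\<parallel>A x\<parallel>\<^sup>2 > t \<parallel>x\<parallel>\<^sup>2\<close> and
  \<open>\<parallel>A x\<parallel>\<^sup>2 \<le> t \<parallel>x\<parallel>\<^sup>2\<close>, which is absurd (\<open>diagonalises_counts\<close>).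

  Singular values are defined through the roots of the characteristic polynomial. The passage to
  eigenvectors is the spectral theorem (\<open>symmetric_matrix_orthonormal_eigenbasis\<close>), together with
  the factorisation of the characteristic polynomial that an orthonormal eigenbasis provides
  (\<open>charpoly_orthonormal_eigenbasis\<close>) and a counting description of the entries of a descending
  list (\<open>nth_desc_iff_card\<close>).\<close>

section \<open>The spectral theorem for real symmetric matrices\<close>

text \<open>A family of orthonormal vectors, indexed by a type; it need not span the space.\<close>

definition orthonormal_family :: "('i \<Rightarrow> 'a::euclidean_space) \<Rightarrow> bool"
  where "orthonormal_family u \<longleftrightarrow> (\<forall>i j. u i \<bullet> u j = (if i = j then 1 else 0))"

lemma orthonormal_familyD: "orthonormal_family u \<Longrightarrow> u i \<bullet> u j = (if i = j then 1 else 0)"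
  by (simp add: orthonormal_family_def)

lemma quadratic_nonneg_imp_linear_term_zero:
  fixes a b :: real
  assumes "b \<ge> 0" and nonneg: "\<And>t. 0 \<le> 2 * t * a + t\<^sup>2 * b"
  shows "a = 0"
proof (rule ccontr)
  assume "a \<noteq> 0"
  define t where "t = - a / (b + 1)"
  have ta: "a = - t * (b + 1)"
    using \<open>b \<ge> 0\<close> by (simp add: t_def field_simps)
  have "t \<noteq> 0"
    using \<open>a \<noteq> 0\<close> ta by auto
  have "2 * t * a + t\<^sup>2 * b = - (t\<^sup>2 * (b + 2))"
    unfolding ta by (simp add: algebra_simps power2_eq_square)
  also have "\<dots> < 0"
    using \<open>b \<ge> 0\<close> \<open>t \<noteq> 0\<close> by (simp add: zero_less_mult_iff)
  finally show False
    using nonneg[of t] by simp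
qed

text \<open>The eigenvector is a maximiser \<open>v\<close> of the quadratic form \<open>x \<bullet> f x\<close> on the unit sphere of \<open>S\<close>:
  the form \<open>\<mu> (x \<bullet> x) - x \<bullet> f x\<close> is nonnegative on \<open>S\<close> and vanishes at \<open>v\<close>, hence so does its
  derivative there.\<close>

lemma selfadjoint_eigenvector_exists:
  fixes f :: "'a::euclidean_space \<Rightarrow> 'a"
  assumes lin: "linear f" and sa: "\<And>x y. f x \<bullet> y = x \<bullet> f y"
    and S: "subspace S" "f ` S \<subseteq> S" "S \<noteq> {0}"
  obtains v \<mu> where "v \<in> S" "norm v = 1" "f v = \<mu> *\<^sub>R v"
proof -
  obtain x where x: "x \<in> S" "x \<noteq> 0"
    using S subspace_0[of S] by auto
  let ?K = "S \<inter> sphere 0 1"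
  have "x /\<^sub>R norm x \<in> ?K"
    using x S(1) by (simp add: subspace_scale)
  moreover have "compact ?K"
    by (simp add: S(1) closed_subspace closed_Int_compact)
  moreover have "continuous_on ?K (\<lambda>x. x \<bullet> f x)"
    using lin by (intro continuous_intros linear_continuous_on) (simp add: linear_conv_bounded_linear)
  ultimately obtain v where v: "v \<in> ?K" and vmax: "\<And>y. y \<in> ?K \<Longrightarrow> y \<bullet> f y \<le> v \<bullet> f v"
    using continuous_attains_sup[of ?K "\<lambda>x. x \<bullet> f x"] by blast
  define \<mu> where "\<mu> = v \<bullet> f v"
  have vv: "v \<bullet> v = 1"
    using v by (simp add: dot_square_norm)
  have bound: "y \<bullet> f y \<le> \<mu> * (y \<bullet> y)" if "y \<in> S" for y
  proof (cases "y = 0")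
    case True
    then show ?thesis by simp
  next
    case False
    define z where "z = y /\<^sub>R norm y"
    have y: "y = norm y *\<^sub>R z"
      using False by (simp add: z_def)
    have "z \<in> ?K"
      using that False S(1) by (simp add: z_def subspace_scale)
    then have "z \<bullet> f z \<le> \<mu>"
      using vmax by (simp add: \<mu>_def)
    then have "(norm y)\<^sup>2 * (z \<bullet> f z) \<le> (norm y)\<^sup>2 * \<mu>"
      by (intro mult_left_mono) auto
    moreover have "y \<bullet> f y = (norm y)\<^sup>2 * (z \<bullet> f z)"
      by (subst (1 2) y) (simp add: linear_cmul[OF lin] power2_eq_square)
    ultimately show ?thesis
      by (simp add: power2_norm_eq_inner mult.commute)
  qed
  \<comment> \<open>Expand the nonnegative form along the line from \<open>v\<close> in the direction of the residual \<open>w\<close>: its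
    linear coefficient is \<open>w \<bullet> w\<close>.\<close>
  define w where "w = \<mu> *\<^sub>R v - f v"
  have wS: "w \<in> S"
    using v S by (auto simp: w_def intro: subspace_diff subspace_scale)
  have "0 \<le> 2 * t * (w \<bullet> w) + t\<^sup>2 * (\<mu> * (w \<bullet> w) - w \<bullet> f w)" for t
  proof -
    have "v + t *\<^sub>R w \<in> S"
      using v wS S(1) by (auto intro: subspace_add subspace_scale)
    then have "0 \<le> \<mu> * ((v + t *\<^sub>R w) \<bullet> (v + t *\<^sub>R w)) - (v + t *\<^sub>R w) \<bullet> f (v + t *\<^sub>R w)"
      using bound by simp
    also have "\<dots> = \<mu> * (v \<bullet> v) - v \<bullet> f v + 2 * t * (\<mu> * (v \<bullet> w) - f v \<bullet> w)
        + t\<^sup>2 * (\<mu> * (w \<bullet> w) - w \<bullet> f w)"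
      by (simp add: linear_add[OF lin] linear_cmul[OF lin] inner_simps sa inner_commute[of w v]
          inner_commute[of w "f v"] algebra_simps power2_eq_square)
    also have "\<mu> * (v \<bullet> w) - f v \<bullet> w = w \<bullet> w"
      by (simp add: w_def inner_simps inner_commute algebra_simps)
    finally show ?thesis
      by (simp add: vv \<mu>_def)
  qed
  moreover have "0 \<le> \<mu> * (w \<bullet> w) - w \<bullet> f w"
    using bound[OF wS] by simp
  ultimately have "w \<bullet> w = 0"
    by (rule quadratic_nonneg_imp_linear_term_zero[rotated])
  then show thesis
    using v that[of v \<mu>] by (simp add: w_def)
qed

text \<open>Induction on the dimension: split off one eigenvector; its orthogonal complement in \<open>S\<close> is
  again invariant.\<close>

lemma selfadjoint_orthonormal_eigenbasis_on:
  fixes f :: "'a::euclidean_space \<Rightarrow> 'a"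
  assumes lin: "linear f" and sa: "\<And>x y. f x \<bullet> y = x \<bullet> f y"
    and "subspace S" "f ` S \<subseteq> S"
  shows "\<exists>B. span B = S \<and> pairwise orthogonal B \<and> (\<forall>b\<in>B. norm b = 1 \<and> (\<exists>\<mu>. f b = \<mu> *\<^sub>R b))"
  using assms(3,4)
proof (induction "dim S" arbitrary: S rule: less_induct)
  case less
  show ?case
  proof (cases "S = {0}")
    case True
    then show ?thesis
      by (intro exI[of _ "{}"]) (simp add: pairwise_def)
  next
    case False
    then obtain v \<mu> where v: "v \<in> S" "norm v = 1" "f v = \<mu> *\<^sub>R v"
      using selfadjoint_eigenvector_exists[OF lin sa less.prems] by metis
    define T where "T = S \<inter> {x. v \<bullet> x = 0}"
    have T: "subspace T"
      unfolding T_def using less.prems(1) by (intro subspace_inter subspace_hyperplane)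
    have "f ` T \<subseteq> T"
      using less.prems(2) v by (auto simp: T_def sa[symmetric])
    moreover have "dim T < dim S"
    proof (rule dim_psubset)
      have "v \<notin> T"
        using v by (auto simp: T_def dot_square_norm)
      then have "T \<subset> S"
        using v(1) unfolding T_def by blast
      then show "span T \<subset> span S"
        using T less.prems(1) by (metis span_eq_iff)
    qed
    ultimately obtain B where B: "span B = T" "pairwise orthogonal B"
        "\<forall>b\<in>B. norm b = 1 \<and> (\<exists>\<mu>. f b = \<mu> *\<^sub>R b)"
      using less.hyps[of T] T by blast
    have BT: "B \<subseteq> T"
      using B(1) span_superset by auto
    have "span (insert v B) = S"
    proof
      show "span (insert v B) \<subseteq> S"
        using v(1) BT less.prems(1) by (intro span_minimal) (auto simp: T_def)
      show "S \<subseteq> span (insert v B)"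
      proof
        fix x assume "x \<in> S"
        then have "x - (v \<bullet> x) *\<^sub>R v \<in> T"
          using v less.prems(1)
          by (auto simp: T_def inner_simps dot_square_norm intro!: subspace_diff subspace_scale)
        then show "x \<in> span (insert v B)"
          using B(1) by (auto simp: span_breakdown_eq)
      qed
    qed
    moreover have "pairwise orthogonal (insert v B)"
      using B(2) BT by (auto simp: pairwise_insert orthogonal_def T_def inner_commute)
    ultimately show ?thesis
      using B(3) v by (intro exI[of _ "insert v B"]) auto
  qed
qed

lemma transpose_inner: "(transpose B *v x) \<bullet> y = x \<bullet> (B *v y)"
  for B :: "real ^ 'n ^ 'm"
  by (metis dot_lmul_matrix vector_transpose_matrix transpose_transpose inner_commute)

lemma gram_inner: "x \<bullet> ((transpose B ** B) *v y) = (B *v x) \<bullet> (B *v y)"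
  for B :: "real ^ 'n ^ 'm"
  by (metis matrix_vector_mul_assoc transpose_inner transpose_transpose)

lemma symmetric_matrix_orthonormal_eigenbasis:
  fixes B :: "real ^ 'n ^ 'n"
  assumes "transpose B = B"
  obtains u :: "'n \<Rightarrow> real ^ 'n" and d :: "'n \<Rightarrow> real"
  where "orthonormal_family u" "\<And>i. B *v u i = d i *\<^sub>R u i"
proof -
  have "\<exists>E. span E = UNIV \<and> pairwise orthogonal E \<and>
      (\<forall>b\<in>E. norm b = 1 \<and> (\<exists>\<mu>. B *v b = \<mu> *\<^sub>R b))"
    using transpose_inner[of B] assms
    by (intro selfadjoint_orthonormal_eigenbasis_on) auto
  then obtain E where E: "span E = UNIV" "pairwise orthogonal E"
      "\<And>b. b \<in> E \<Longrightarrow> norm b = 1" "\<And>b. b \<in> E \<Longrightarrow> \<exists>\<mu>. B *v b = \<mu> *\<^sub>R b"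
    by blast
  have ind: "independent E"
    using E(2,3) by (intro pairwise_orthogonal_independent) force+
  then have "card E = CARD('n)"
    using dim_eq_card[of E UNIV] E(1) by (simp add: dim_eq_card span_UNIV)
  then obtain u where u: "bij_betw u (UNIV :: 'n set) E"
    using finite_same_card_bij[of "UNIV :: 'n set" E] ind independent_imp_finite by auto
  then have uE: "u i \<in> E" for i
    by (auto simp: bij_betw_def)
  have "orthonormal_family u"
    unfolding orthonormal_family_def
  proof (intro allI)
    fix i j
    show "u i \<bullet> u j = (if i = j then 1 else 0)"
    proof (cases "i = j")
      case True
      then show ?thesis using E(3)[OF uE] by (simp add: dot_square_norm)
    next
      case False
      then have "u i \<noteq> u j" using u by (auto simp: bij_betw_def inj_def)
      then show ?thesis using False E(2) uE by (simp add: pairwise_def orthogonal_def)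
    qed
  qed
  moreover have "\<forall>i. \<exists>\<mu>. B *v u i = \<mu> *\<^sub>R u i"
    using E(4)[OF uE] by blast
  then obtain d where "\<forall>i. B *v u i = d i *\<^sub>R u i"
    using choice[of "\<lambda>i \<mu>. B *v u i = \<mu> *\<^sub>R u i"] by blast
  ultimately show thesis
    using that by blast
qed

section \<open>Eigenvalues as roots of the characteristic polynomial\<close>

text \<open>Over the polynomial ring, \<open>(x I - B) Q = Q diag(x - d\<^sub>i)\<close> for the matrix \<open>Q\<close> of eigenvectors,
  whose determinant is cancellable. As there are as many \<open>u i\<close> as
  dimensions, orthonormality alone makes them a basis.\<close>

lemma charpoly_orthonormal_eigenbasis:
  fixes B :: "real ^ 'n ^ 'n"
  assumes on: "orthonormal_family u" and ev: "\<And>i::'n. B *v u i = d i *\<^sub>R u i"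
  shows "charpoly B = (\<Prod>i\<in>UNIV. [:- d i, 1:])"
proof -
  define c :: "real ^ 'n ^ 'n \<Rightarrow> real poly ^ 'n ^ 'n" where "c M = (\<chi> i j. [:M $ i $ j:])" for M
  have sum_const: "(\<Sum>k\<in>UNIV. [:g k:]) = [:\<Sum>k\<in>UNIV. g k:]" for g :: "'n \<Rightarrow> real"
    by (rule sum_to_poly)
  have c_mult: "c (M ** N) = c M ** c N" for M N
    by (simp add: c_def matrix_matrix_mult_def vec_eq_iff sum_const mult.commute)
  have c_one: "c (mat 1) = mat 1"
    by (simp add: c_def mat_def vec_eq_iff one_pCons)
  define Q where "Q = (\<chi> i j. u j $ i)"
  define D :: "real poly ^ 'n ^ 'n" where "D = (\<chi> i j. if i = j then [:- d i, 1:] else 0)"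
  have "transpose Q ** Q = mat 1"
    using orthonormal_familyD[OF on]
    by (simp add: vec_eq_iff matrix_matrix_mult_def transpose_def Q_def mat_def inner_vec_def)
  then have "det (c (transpose Q)) * det (c Q) = 1"
    by (metis c_mult c_one det_I det_mul)
  then have nz: "det (c Q) \<noteq> 0"
    by auto
  have BQ: "(\<Sum>k\<in>UNIV. B $ i $ k * Q $ k $ j) = d j * Q $ i $ j" for i j
    using arg_cong[OF ev[of j], of "\<lambda>v. v $ i"] by (simp add: matrix_vector_mult_def Q_def)
  have "(mat [:0, 1:] - c B) ** c Q = c Q ** D"
  proof -
    have "((mat [:0, 1:] - c B) ** c Q) $ i $ j = (c Q ** D) $ i $ j" for i j
    proof -
      have "((mat [:0, 1:] - c B) ** c Q) $ i $ j
          = (\<Sum>k\<in>UNIV. (if i = k then [:0, 1:] else 0) * [:Q $ k $ j:])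
            - (\<Sum>k\<in>UNIV. [:B $ i $ k:] * [:Q $ k $ j:])"
        unfolding sum_subtractf[symmetric] left_diff_distrib[symmetric]
        by (simp add: matrix_matrix_mult_def c_def mat_def)
      also have "(\<Sum>k\<in>UNIV. [:B $ i $ k:] * [:Q $ k $ j:]) = [:d j * Q $ i $ j:]"
        using BQ by (simp add: sum_const mult.commute)
      also have "(\<Sum>k\<in>UNIV. (if i = k then [:0, 1:] else 0) * [:Q $ k $ j:]) = [:0, Q $ i $ j:]"
        by (simp add: if_distrib[of "smult _"] cong: if_cong)
      also have "[:0, Q $ i $ j:] - [:d j * Q $ i $ j:] = [:Q $ i $ j:] * [:- d j, 1:]"
        by simp
      also have "\<dots> = (c Q ** D) $ i $ j"
        by (simp add: matrix_matrix_mult_def c_def D_def if_distrib[of "\<lambda>x. _ * x"] cong: if_cong)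
      finally show ?thesis .
    qed
    then show ?thesis
      by (simp add: vec_eq_iff)
  qed
  then have "det (mat [:0, 1:] - c B) * det (c Q) = det D * det (c Q)"
    by (metis det_mul mult.commute)
  then have "det (mat [:0, 1:] - c B) = det D"
    using nz by simp
  also have "\<dots> = (\<Prod>i\<in>UNIV. [:- d i, 1:])"
    by (subst det_diagonal) (auto simp: D_def)
  finally show ?thesis
    by (simp add: charpoly_def c_def)
qed

lemma eigenvalues_desc_orthonormal_eigenbasis:
  fixes B :: "real ^ 'n ^ 'n"
  assumes "orthonormal_family u" and "\<And>i::'n. B *v u i = d i *\<^sub>R u i"
  shows "eigenvalues_desc B = rev (sorted_list_of_multiset (image_mset d (mset_set UNIV)))"
proof -
  have "proots (charpoly B) = (\<Sum>i\<in>UNIV. {#d i#})"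
    unfolding charpoly_orthonormal_eigenbasis[OF assms]
    by (subst proots_prod) auto
  also have "\<dots> = image_mset d (mset_set UNIV)"
    by (simp add: sum_unfold_sum_mset)
  finally show ?thesis
    by (simp add: eigenvalues_desc_def)
qed

text \<open>Position \<open>j\<close> counts from 0. The predicate \<open>Q\<close> is a lower threshold, strict or not.\<close>

lemma nth_desc_iff_card:
  fixes d :: "'i::finite \<Rightarrow> real"
  assumes up: "\<And>x y. Q x \<Longrightarrow> x \<le> y \<Longrightarrow> Q y" and j: "j < CARD('i)"
  shows "Q (rev (sorted_list_of_multiset (image_mset d (mset_set UNIV))) ! j)
    \<longleftrightarrow> j < card {i. Q (d i)}"
proof -
  define L where "L = rev (sorted_list_of_multiset (image_mset d (mset_set (UNIV :: 'i set))))"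
  have mL: "mset L = image_mset d (mset_set UNIV)"
    by (simp add: L_def)
  then have len: "length L = CARD('i)"
    by (metis size_mset size_image_mset size_mset_set)
  have desc: "L ! b \<le> L ! a" if "a \<le> b" "b < length L" for a b
    using that sorted_rev_nth_mono[of L a b] by (simp add: L_def)
  have "card {i. Q (d i)} = size (filter_mset Q (image_mset d (mset_set (UNIV :: 'i set))))"
    by (simp add: filter_mset_image_mset)
  also have "\<dots> = length (filter Q L)"
    by (metis mL mset_filter size_mset)
  also have "\<dots> = card {m. m < length L \<and> Q (L ! m)}"
    by (rule length_filter_conv_card)
  finally have card: "card {i. Q (d i)} = card {m. m < length L \<and> Q (L ! m)}" .
  have "j < card {m. m < length L \<and> Q (L ! m)}" if "Q (L ! j)"
  proof -
    have "{..j} \<subseteq> {m. m < length L \<and> Q (L ! m)}"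
      using that up desc j len by auto
    then have "card {..j} \<le> card {m. m < length L \<and> Q (L ! m)}"
      by (rule card_mono[rotated]) simp
    then show ?thesis by simp
  qed
  moreover have "card {m. m < length L \<and> Q (L ! m)} \<le> j" if "\<not> Q (L ! j)"
  proof -
    have "{m. m < length L \<and> Q (L ! m)} \<subseteq> {..<j}"
      using that up desc j len by (auto simp: not_le[symmetric])
    then have "card {m. m < length L \<and> Q (L ! m)} \<le> card {..<j}"
      by (rule card_mono[rotated]) simp
    then show ?thesis by simp
  qed
  ultimately show ?thesis
    unfolding card L_def[symmetric] by (meson not_le)
qed

section \<open>Interlacing of singular values\<close>

lemma span_orthonormal_family:
  fixes u :: "'i::finite \<Rightarrow> 'a::euclidean_space"
  assumes on: "orthonormal_family u"
  shows "dim (span (u ` I)) = card I"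
    and "x \<in> span (u ` I) \<Longrightarrow> \<exists>a. x = (\<Sum>i\<in>I. a i *\<^sub>R u i)"
proof -
  have inj: "inj u"
    by (rule injI) (metis on orthonormal_familyD zero_neq_one)
  have "independent (u ` I)"
  proof (rule pairwise_orthogonal_independent)
    show "pairwise orthogonal (u ` I)"
      using orthonormal_familyD[OF on] by (auto simp: pairwise_def orthogonal_def)
    show "0 \<notin> u ` I"
      using orthonormal_familyD[OF on] by (metis (full_types) imageE inner_zero_left zero_neq_one)
  qed
  then show "dim (span (u ` I)) = card I"
    by (simp add: dim_eq_card_independent card_image inj_on_subset[OF inj])
  assume "x \<in> span (u ` I)"
  then obtain b where "x = (\<Sum>y\<in>u ` I. b y *\<^sub>R y)"
    by (auto simp: span_finite)
  then have "x = (\<Sum>i\<in>I. b (u i) *\<^sub>R u i)"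
    by (simp add: sum.reindex inj_on_subset[OF inj] o_def)
  then show "\<exists>a. x = (\<Sum>i\<in>I. a i *\<^sub>R u i)"
    by (intro exI[of _ "\<lambda>i. b (u i)"])
qed

text \<open>The orthonormal vectors \<open>u i\<close> have mutually orthogonal images under \<open>f\<close>, of squared norms
  \<open>d i\<close>: the quadratic form \<open>\<parallel>f x\<parallel>\<^sup>2\<close> is diagonal on their span. They need not be eigenvectors of
  \<open>f\<^sup>T f\<close> nor span the whole space, so that the notion survives the passage from \<open>A P\<close> to \<open>A\<close>.\<close>

definition diagonalises :: "('a::euclidean_space \<Rightarrow> 'b::euclidean_space) \<Rightarrow> ('i \<Rightarrow> 'a) \<Rightarrow> ('i \<Rightarrow> real) \<Rightarrow> bool"
  where "diagonalises f u d \<longleftrightarrow> orthonormal_family u \<and>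
    (\<forall>i j. f (u i) \<bullet> f (u j) = (if i = j then d i else 0))"

lemma inner_sum_family:
  fixes v :: "'i::finite \<Rightarrow> 'a::real_inner"
  assumes "\<And>i j. v i \<bullet> v j = (if i = j then d i else 0)"
  shows "(\<Sum>i\<in>I. a i *\<^sub>R v i) \<bullet> (\<Sum>i\<in>I. a i *\<^sub>R v i) = (\<Sum>i\<in>I. d i * (a i)\<^sup>2)"
  by (simp add: inner_sum_left inner_sum_right assms power2_eq_square mult_ac
      if_distrib[of "\<lambda>x. _ * x"] sum.If_cases cong: if_cong)

text \<open>The dimension count behind both interlacing inequalities; the two families play symmetric
  roles.\<close>

lemma diagonalises_counts:
  fixes f :: "'a::euclidean_space \<Rightarrow> 'b::euclidean_space"
    and u :: "'i::finite \<Rightarrow> 'a" and w :: "'j::finite \<Rightarrow> 'a"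
  assumes lin: "linear f" and u: "diagonalises f u c" and w: "diagonalises f w d"
  shows "card {i. t < c i} + card {j. d j \<le> t} \<le> DIM('a)"
proof (rule ccontr)
  let ?I = "{i. t < c i}" and ?J = "{j. d j \<le> t}"
  assume "\<not> ?thesis"
  then have big: "DIM('a) < card ?I + card ?J" by simp
  have onu: "orthonormal_family u" and onw: "orthonormal_family w"
    using u w by (auto simp: diagonalises_def)
  let ?U = "span (u ` ?I)" and ?W = "span (w ` ?J)"
  have "dim {x + y |x y. x \<in> ?U \<and> y \<in> ?W} + dim (?U \<inter> ?W) = dim ?U + dim ?W"
    by (rule dim_sums_Int) auto
  moreover have "dim {x + y |x y. x \<in> ?U \<and> y \<in> ?W} \<le> DIM('a)"
    by (rule dim_subset_UNIV)
  ultimately have "dim (?U \<inter> ?W) \<noteq> 0"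
    using big span_orthonormal_family(1)[OF onu, of ?I] span_orthonormal_family(1)[OF onw, of ?J]
    by linarith
  then obtain x where x: "x \<in> ?U" "x \<in> ?W" "x \<noteq> 0"
    by (auto simp: dim_eq_0)
  obtain a where a: "x = (\<Sum>i\<in>?I. a i *\<^sub>R u i)"
    using span_orthonormal_family(2)[OF onu x(1)] by blast
  obtain b where b: "x = (\<Sum>j\<in>?J. b j *\<^sub>R w j)"
    using span_orthonormal_family(2)[OF onw x(2)] by blast
  have xx_a: "x \<bullet> x = (\<Sum>i\<in>?I. (a i)\<^sup>2)" and xx_b: "x \<bullet> x = (\<Sum>j\<in>?J. (b j)\<^sup>2)"
    using inner_sum_family[of u "\<lambda>_. 1" a ?I] inner_sum_family[of w "\<lambda>_. 1" b ?J]
      orthonormal_familyD[OF onu] orthonormal_familyD[OF onw] a[symmetric] b[symmetric]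
    by simp_all
  have fx_a: "f x \<bullet> f x = (\<Sum>i\<in>?I. c i * (a i)\<^sup>2)"
    using u inner_sum_family[of "\<lambda>i. f (u i)" c]
    by (simp add: a linear_sum[OF lin] linear_cmul[OF lin] diagonalises_def)
  have fx_b: "f x \<bullet> f x = (\<Sum>j\<in>?J. d j * (b j)\<^sup>2)"
    using w inner_sum_family[of "\<lambda>i. f (w i)" d]
    by (simp add: b linear_sum[OF lin] linear_cmul[OF lin] diagonalises_def)
  have "f x \<bullet> f x \<le> t * (x \<bullet> x)"
    unfolding fx_b xx_b sum_distrib_left by (intro sum_mono mult_right_mono) auto
  moreover have "t * (x \<bullet> x) < f x \<bullet> f x"
  proof -
    obtain i where i: "i \<in> ?I" "a i \<noteq> 0"
      using a x(3) by (metis (mono_tags, lifting) scale_eq_0_iff sum.neutral)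
    show ?thesis
      unfolding fx_a xx_a sum_distrib_left
      by (rule sum_strict_mono_ex1) (use i in \<open>auto intro!: mult_right_mono bexI[of _ i]\<close>)
  qed
  ultimately show False by simp
qed

lemma diagonalises_gram:
  fixes B :: "real ^ 'n ^ 'm"
  assumes on: "orthonormal_family u" and ev: "\<And>i. (transpose B ** B) *v u i = d i *\<^sub>R u i"
  shows "diagonalises ((*v) B) u d"
  unfolding diagonalises_def gram_inner[symmetric] ev
  using on by (simp add: orthonormal_family_def)

lemma gram_orthonormal_eigenbasis:
  fixes B :: "real ^ 'n ^ 'm"
  obtains u :: "'n \<Rightarrow> real ^ 'n" and d :: "'n \<Rightarrow> real"
  where "orthonormal_family u" "\<And>i. (transpose B ** B) *v u i = d i *\<^sub>R u i"
proof -
  have "transpose (transpose B ** B) = transpose B ** B"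
    by (simp add: matrix_transpose_mul)
  then show thesis
    by (rule symmetric_matrix_orthonormal_eigenbasis) (rule that)
qed

lemma isometry_inner:
  fixes P :: "real ^ 'l ^ 'n"
  assumes "transpose P ** P = mat 1"
  shows "(P *v x) \<bullet> (P *v y) = x \<bullet> y"
  by (metis assms gram_inner matrix_vector_mul_lid)

lemma isometry_norm:
  fixes P :: "real ^ 'l ^ 'n"
  assumes "transpose P ** P = mat 1"
  shows "norm (P *v x) = norm x"
  by (simp add: norm_eq_sqrt_inner isometry_inner[OF assms])

lemma isometry_transpose_norm_le:
  fixes P :: "real ^ 'l ^ 'n"
  assumes "transpose P ** P = mat 1"
  shows "norm (transpose P *v x) \<le> norm x"
proof -
  let ?y = "transpose P *v x"
  have "norm ?y * norm ?y = x \<bullet> (P *v ?y)"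
    by (simp add: transpose_inner[symmetric] power2_eq_square[symmetric] power2_norm_eq_inner)
  also have "\<dots> \<le> norm x * norm ?y"
    using norm_cauchy_schwarz[of x "P *v ?y"] by (simp add: isometry_norm[OF assms])
  finally show ?thesis
    by (cases "norm ?y = 0") auto
qed

lemma diagonalises_isometry:
  fixes A :: "real ^ 'n ^ 'm" and P :: "real ^ 'l ^ 'n"
  assumes P: "transpose P ** P = mat 1" and "diagonalises ((*v) (A ** P)) u d"
  shows "diagonalises ((*v) A) (\<lambda>i. P *v u i) d"
  using assms(2)
  by (simp add: diagonalises_def orthonormal_family_def isometry_inner[OF P]
      matrix_vector_mul_assoc)

lemma card_le_threshold:
  fixes f :: "'i::finite \<Rightarrow> real"
  shows "card {i. f i \<le> t} = CARD('i) - card {i. t < f i}"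
proof -
  have "{i. f i \<le> t} = UNIV - {i. t < f i}" by auto
  then show ?thesis by (simp add: card_Diff_subset)
qed

text \<open>The Cauchy--Poincare separation theorem for \<open>A\<^sup>T A\<close> and its compression to the column space of
  \<open>P\<close>, with positions counted from 0.\<close>

lemma
  fixes A :: "real ^ 'n ^ 'm" and P :: "real ^ 'l ^ 'n"
  assumes P: "transpose P ** P = mat 1" and le: "CARD('l) \<le> CARD('n)" and j: "j < CARD('l)"
  shows gram_eigenvalue_isometry_le:
      "eigenvalues_desc (transpose (A ** P) ** (A ** P)) ! j \<le> eigenvalues_desc (transpose A ** A) ! j"
    and gram_eigenvalue_isometry_ge:
      "eigenvalues_desc (transpose A ** A) ! (j + (CARD('n) - CARD('l)))
        \<le> eigenvalues_desc (transpose (A ** P) ** (A ** P)) ! j"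
proof -
  define a where "a = eigenvalues_desc (transpose A ** A)"
  define c where "c = eigenvalues_desc (transpose (A ** P) ** (A ** P))"
  obtain u :: "'n \<Rightarrow> real ^ 'n" and d :: "'n \<Rightarrow> real"
    where u: "orthonormal_family u" "\<And>i. (transpose A ** A) *v u i = d i *\<^sub>R u i"
    using gram_orthonormal_eigenbasis[of A] by blast
  obtain v :: "'l \<Rightarrow> real ^ 'l" and e :: "'l \<Rightarrow> real"
    where v: "orthonormal_family v"
      "\<And>i. (transpose (A ** P) ** (A ** P)) *v v i = e i *\<^sub>R v i"
    using gram_orthonormal_eigenbasis[of "A ** P"] by blast
  have du: "diagonalises ((*v) A) u d"
    by (rule diagonalises_gram[OF u])
  have dv: "diagonalises ((*v) A) (\<lambda>i. P *v v i) e"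
    by (rule diagonalises_isometry[OF P diagonalises_gram[OF v]])
  have a_iff: "t < a ! i \<longleftrightarrow> i < card {i. t < d i}" if "i < CARD('n)" for i t
    unfolding a_def eigenvalues_desc_orthonormal_eigenbasis[OF u]
    using that by (intro nth_desc_iff_card) auto
  have c_iff: "t < c ! j \<longleftrightarrow> j < card {i. t < e i}" for t
    unfolding c_def eigenvalues_desc_orthonormal_eigenbasis[OF v]
    using j by (intro nth_desc_iff_card) auto
  have count1: "card {i. t < e i} + card {i. d i \<le> t} \<le> CARD('n)" for t
    using diagonalises_counts[OF _ dv du, of t] by simp
  have count2: "card {i. t < d i} + card {i. e i \<le> t} \<le> CARD('n)" for t
    using diagonalises_counts[OF _ du dv, of t] by simp
  have "c ! j \<le> a ! j"
  proof (rule ccontr)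
    assume "\<not> c ! j \<le> a ! j"
    then have "a ! j < c ! j" by (rule not_le_imp_less)
    then have "j < card {i. a ! j < e i}"
      by (rule iffD1[OF c_iff])
    moreover have "\<not> j < card {i. a ! j < d i}"
      using a_iff[of j "a ! j"] j le by (meson less_irrefl less_le_trans)
    ultimately show False
      using count1[of "a ! j"] j le unfolding card_le_threshold[of d "a ! j"] by linarith
  qed
  then show "eigenvalues_desc (transpose (A ** P) ** (A ** P)) ! j
      \<le> eigenvalues_desc (transpose A ** A) ! j"
    by (simp only: a_def c_def)
  have "a ! (j + (CARD('n) - CARD('l))) \<le> c ! j"
  proof (rule ccontr)
    assume "\<not> a ! (j + (CARD('n) - CARD('l))) \<le> c ! j"
    then have less: "c ! j < a ! (j + (CARD('n) - CARD('l)))" by (rule not_le_imp_less)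
    have "j + (CARD('n) - CARD('l)) < CARD('n)"
      using j le by linarith
    then have "j + (CARD('n) - CARD('l)) < card {i. c ! j < d i}"
      by (rule iffD1[OF a_iff less])
    moreover have "\<not> j < card {i. c ! j < e i}"
      using c_iff[of "c ! j"] by (meson less_irrefl)
    ultimately show False
      using count2[of "c ! j"] j le unfolding card_le_threshold[of e "c ! j"] by linarith
  qed
  then show "eigenvalues_desc (transpose A ** A) ! (j + (CARD('n) - CARD('l)))
      \<le> eigenvalues_desc (transpose (A ** P) ** (A ** P)) ! j"
    by (simp only: a_def c_def)
qed

section \<open>The error of a truncated singular value decomposition\<close>

lemma compact_svd_gram_eigenbasis:
  assumes "compact_svd B U S V"
  shows "orthonormal_family (\<lambda>i. column i V)"
    and "(transpose B ** B) *v column i V = (S $ i $ i)\<^sup>2 *\<^sub>R column i V"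
proof -
  have B: "B = U ** S ** transpose V" and U: "transpose U ** U = mat 1"
    and V: "transpose V ** V = mat 1" and S: "\<And>i j. i \<noteq> j \<Longrightarrow> S $ i $ j = 0"
    using assms by (auto simp: compact_svd_def orthogonal_matrix_def)
  have col: "column i V = V *v axis i 1" for i
    by (simp add: matrix_vector_mult_basis)
  show "orthonormal_family (\<lambda>i. column i V)"
    by (simp add: orthonormal_family_def col isometry_inner[OF V] inner_axis_axis)
  have Sax: "S *v axis i 1 = (S $ i $ i) *\<^sub>R axis i 1" for i
    unfolding matrix_vector_mult_basis using S by (auto simp: column_def vec_eq_iff axis_def)
  have tS: "transpose S = S"
    using S by (auto simp: transpose_def vec_eq_iff) (metis S)
  have "transpose B ** B = V ** S ** (transpose U ** U) ** S ** transpose V"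
    by (simp add: B matrix_transpose_mul tS matrix_mul_assoc)
  then have "transpose B ** B ** V = V ** S ** S ** (transpose V ** V)"
    by (simp add: U matrix_mul_assoc)
  then have gram: "transpose B ** B ** V = V ** S ** S"
    by (simp add: V)
  have "(transpose B ** B) *v column i V = V *v (S *v (S *v axis i 1))"
    by (simp add: col matrix_vector_mul_assoc gram matrix_mul_assoc)
  also have "\<dots> = (S $ i $ i)\<^sup>2 *\<^sub>R column i V"
    by (simp add: Sax matrix_vector_mult_scaleR col power2_eq_square)
  finally show "(transpose B ** B) *v column i V = (S $ i $ i)\<^sup>2 *\<^sub>R column i V" .
qed

text \<open>A discarded diagonal entry is dominated by the \<open>k + 1\<close> or more entries up to its own position,
  so its square is at most the eigenvalue in position \<open>k\<close>.\<close>

lemma compact_svd_discarded_le: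
  fixes B :: "real ^ 'l::{finite,linorder} ^ 'm"
  assumes svd: "compact_svd B U S V" and k: "k < CARD('l)" and i: "k \<le> card {..<i}"
  shows "S $ i $ i \<le> singular_value B (k + 1)"
proof -
  have nonneg: "\<And>j. 0 \<le> S $ j $ j" and desc: "\<And>j. j \<le> i \<Longrightarrow> S $ i $ i \<le> S $ j $ j"
    using svd by (auto simp: compact_svd_def)
  have "{..i} \<subseteq> {j. (S $ i $ i)\<^sup>2 \<le> (S $ j $ j)\<^sup>2}"
    using nonneg desc by (auto intro: power_mono)
  then have "card {..i} \<le> card {j. (S $ i $ i)\<^sup>2 \<le> (S $ j $ j)\<^sup>2}"
    by (rule card_mono[rotated]) simp
  moreover have "card {..i} = Suc (card {..<i})"
  proof -
    have "{..i} = insert i {..<i}" by auto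
    then show ?thesis by simp
  qed
  ultimately have "k < card {j. (S $ i $ i)\<^sup>2 \<le> (S $ j $ j)\<^sup>2}"
    using i by linarith
  then have "(S $ i $ i)\<^sup>2 \<le> eigenvalues_desc (transpose B ** B) ! k"
    unfolding eigenvalues_desc_orthonormal_eigenbasis[OF compact_svd_gram_eigenbasis[OF svd]]
    using k by (subst nth_desc_iff_card) auto
  then show ?thesis
    by (simp add: singular_value_def real_le_rsqrt)
qed

lemma svd_truncation_error:
  fixes B :: "real ^ 'l::{finite,linorder} ^ 'm"
  assumes svd: "compact_svd B U S V" and k: "k < CARD('l)"
  shows "norm ((B - svd_truncation k U S V) *v x) \<le> singular_value B (k + 1) * norm x"
proof -
  have B: "B = U ** S ** transpose V" and U: "transpose U ** U = mat 1"
    and V: "V ** transpose V = mat 1" and S: "\<And>i j. i \<noteq> j \<Longrightarrow> S $ i $ j = 0"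
    and nonneg: "\<And>i. 0 \<le> S $ i $ i"
    using svd by (auto simp: compact_svd_def orthogonal_matrix_def)
  define Sk where "Sk = (\<chi> i j. if card {..<i} < k then S $ i $ j else 0)"
  define y where "y = transpose V *v x"
  let ?s = "singular_value B (k + 1)"
  have comp: "((S - Sk) *v y) $ i = (if card {..<i} < k then 0 else S $ i $ i * y $ i)" for i
  proof -
    have "((S - Sk) *v y) $ i = (\<Sum>j\<in>UNIV. (S - Sk) $ i $ j * y $ j)"
      by (simp add: matrix_vector_mult_def)
    also have "\<dots> = (\<Sum>j\<in>UNIV. if j = i then (S - Sk) $ i $ i * y $ i else 0)"
      by (rule sum.cong) (auto simp: Sk_def S)
    finally show ?thesis
      by (simp add: Sk_def)
  qed
  have "(B - svd_truncation k U S V) *v x = U *v ((S - Sk) *v y)"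
    by (simp add: B svd_truncation_def Sk_def[symmetric] y_def matrix_vector_mult_diff_rdistrib
        matrix_vector_mult_diff_distrib matrix_vector_mul_assoc[symmetric])
  then have "norm ((B - svd_truncation k U S V) *v x) = norm ((S - Sk) *v y)"
    by (simp add: isometry_norm[OF U])
  also have "\<dots> \<le> norm (?s *\<^sub>R y)"
  proof (rule norm_le_componentwise_cart)
    fix i
    have "\<bar>S $ i $ i\<bar> \<le> \<bar>?s\<bar>" if "\<not> card {..<i} < k"
      using compact_svd_discarded_le[OF svd k, of i] nonneg[of i] that by simp
    then show "norm (((S - Sk) *v y) $ i) \<le> norm ((?s *\<^sub>R y) $ i)"
      by (simp add: comp abs_mult mult_right_mono)
  qed
  also have "\<dots> = \<bar>?s\<bar> * norm x"
    using isometry_norm[of "transpose V" x] V by (simp add: y_def)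
  \<comment> \<open>The last diagonal entry is discarded, so \<open>?s\<close> is bounded below by a nonnegative number.\<close>
  also have "\<bar>?s\<bar> = ?s"
  proof -
    have "\<exists>i::'l. k \<le> card {..<i}"
    proof (intro exI)
      have "{..<Max (UNIV :: 'l set)} = UNIV - {Max UNIV}"
        by (auto simp: less_le)
      then show "k \<le> card {..<Max (UNIV :: 'l set)}"
        using k by simp
    qed
    then show ?thesis
      using compact_svd_discarded_le[OF svd k] nonneg by (metis abs_of_nonneg order_trans)
  qed
  finally show ?thesis .
qed

section \<open>The randomized singular value decomposition\<close>

theorem theorem5p2:
  fixes A :: "real ^ 'n ^ 'm"
    and M :: "'w measure"
    and \<Omega> :: "'w \<Rightarrow> real ^ 'l::{finite,linorder} ^ 'm"
    and P :: "real ^ 'l::{finite,linorder} ^ 'n"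
    and Ak :: "real ^ 'n ^ 'm"
    and k p :: nat
    and \<omega> :: 'w
  assumes "k \<ge> 1" and "p \<ge> 1"
    and "CARD('l) = k + p"
    and "k + p \<le> min CARD('m) CARD('n)"
    and "gaussian_matrix M \<Omega>"
    and "\<omega> \<in> space M"
    and "rsvd_right k A (\<Omega> \<omega>) P Ak"
  shows "matrix_2norm (A - Ak) \<le>
           singular_value (A ** P) (k + 1) + matrix_2norm (A ** (mat 1 - P ** transpose P))
       \<and> singular_value A (CARD('n) - p + 1) \<le> singular_value (A ** P) (k + 1)
       \<and> singular_value (A ** P) (k + 1) \<le> singular_value A (k + 1)"
proof (intro conjI)
  obtain R U S V where P: "transpose P ** P = mat 1" and svd: "compact_svd (A ** P) U S V"
      and Ak: "Ak = svd_truncation k U S V ** transpose P"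
    using assms(7) by (auto simp: rsvd_right_def compact_qr_def)
  have k: "k < CARD('l)" and le: "CARD('l) \<le> CARD('n)"
    using assms(2-4) by auto
  let ?T = "svd_truncation k U S V" and ?s = "singular_value (A ** P) (k + 1)"
    and ?E = "A ** (mat 1 - P ** transpose P)"
  have error: "norm ((A ** P - ?T) *v x) \<le> ?s * norm x" for x
    by (rule svd_truncation_error[OF svd k])
  have s: "0 \<le> ?s"
    using order_trans[OF norm_ge_zero error[of "axis undefined 1"]] by simp
  show "matrix_2norm (A - Ak) \<le> ?s + matrix_2norm ?E"
  proof (rule onorm_bound)
    show "0 \<le> ?s + matrix_2norm ?E"
      using s by (simp add: onorm_pos_le)
    fix x
    have "(A - Ak) *v x = (A ** P - ?T) *v (transpose P *v x) + ?E *v x"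
      by (simp add: Ak matrix_vector_mult_diff_rdistrib matrix_vector_mult_diff_distrib
          matrix_vector_mul_assoc[symmetric])
    then have "norm ((A - Ak) *v x)
        \<le> norm ((A ** P - ?T) *v (transpose P *v x)) + norm (?E *v x)"
      by (simp add: norm_triangle_ineq)
    also have "norm ((A ** P - ?T) *v (transpose P *v x)) \<le> ?s * norm x"
      by (rule order_trans[OF error mult_left_mono[OF isometry_transpose_norm_le[OF P] s]])
    also have "norm (?E *v x) \<le> matrix_2norm ?E * norm x"
      by (rule onorm) simp
    finally show "norm ((A - Ak) *v x) \<le> (?s + matrix_2norm ?E) * norm x"
      by (simp add: distrib_right)
  qed
  have "k + (CARD('n) - CARD('l)) = CARD('n) - p"
    using assms(3,4) by simp
  then show "singular_value A (CARD('n) - p + 1) \<le> ?s"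
    using gram_eigenvalue_isometry_ge[OF P le k, of A] by (simp add: singular_value_def)
  show "?s \<le> singular_value A (k + 1)"
    using gram_eigenvalue_isometry_le[OF P le k, of A] by (simp add: singular_value_def)
qed

end
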